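(* Let $\mathsf P,\mathsf H$ be Polish spaces, let $\ell:\mathbb R^n\times\mathsf P\to[0,+\infty]$ and $\mathcal A:\mathsf H\times\mathbb R^n\times\mathsf P\to\mathbb R^n$ be measurable, and fix $x^{(0)}\in\mathbb R^n$. Let $P,P_1,\dots,P_N$ be i.i.d. $\mathsf P$-valued random variables, put $D=(P_1,\dots,P_N)$, and let $H$ be an $\mathsf H$-valued random variable independent of $D$ and of $P$. Let $g:\mathsf P\to\mathbb R$ be measurable with $\mathbb E_P[g^2]<\infty$, and assume that the sublevel probability $\pi$ satisfies $\mathbb P_H\{\pi>0\}=1$. Define, for $\gamma>0$, $h\in\mathsf H$, $d\in\mathsf P^N$, $$\eta(\gamma):=\left(\gamma,\ -\frac{\gamma^2}2\right),\qquad T(h,d):=\left(\mathcal R_g(h)-\hat{\mathcal R}_g(h,d),\ \frac{1}{\pi(h)^2N}\,\mathbb E_P\left[g^2\mathbf 1_{\mathsf L_{g,h}}\right]\right),$$ and $c(\gamma,d):=\int_{\mathsf H}\exp(\langle\eta(\gamma),T(h,d)\rangle)\,\mathbb P_H(dh)$. Then $\mathbb E[c(\gamma,D)]\le1$ for all $\gamma>0$.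
   Context: Spaces carry their Borel $\sigma$-algebras and products carry product $\sigma$-algebras. All random variables live on one probability space $(\Omega,\mathcal F,\mathbb P)$; $\mathbb P_X$ is the law of $X$ and $\mathbb E_P$ is integration with respect to $\mathbb P_P$. Write $\ell(h,p):=\ell(\mathcal A(h,x^{(0)},p),p)$ for $h\in\mathsf H$, $p\in\mathsf P$. Sublevel set: $\mathsf L_g:=\{(h,p)\in\mathsf H\times\mathsf P:\ell(h,p)\le g(p)\}$, with sections $\mathsf L_{g,h}:=\{p\in\mathsf P:(h,p)\in\mathsf L_g\}$. Sublevel probability: $\pi(h):=\mathbb P_{P\mid H=h}[\mathsf L_{g,h}]$, where $\mathbb P_{P\mid H=h}$ is a regular conditional distribution of $P$ given $H$; since $P$ and $H$ are independent, $\pi(h)=\mathbb P_P[\mathsf L_{g,h}]$ for $\mathbb P_H$-a.e. $h$. Sublevel risk: $\mathcal R_g(h):=\frac1{\pi(h)}\mathbb E_P[\ell(h,\cdot)\mathbf 1_{\mathsf L_{g,h}}]$ if $\pi(h)>0$ and $\mathcal R_g(h):=0$ otherwise. Empirical sublevel risk: $\hat{\mathcal R}_g(h,d):=\frac{1}{\pi(h)}\frac1N\sum_{i=1}^N\mathbf 1_{\mathsf L_{g,h}}(p_i)\,\ell(h,p_i)$ for $d=(p_1,\dots,p_N)$ (with $\pi(h)>0$ for $\mathbb P_H$-a.e. $h$). *)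

theory Defs
  imports "HOL-Probability.Probability"
begin

definition iid :: "'w measure \<Rightarrow> ('i \<Rightarrow> 'w \<Rightarrow> 'a::topological_space) \<Rightarrow> 'i set \<Rightarrow> bool" where
  "iid M X I \<longleftrightarrow> prob_space.indep_vars M (\<lambda>_. borel) X I \<and>
     (\<forall>i\<in>I. \<forall>j\<in>I. distr M borel (X i) = distr M borel (X j))"

text \<open>
  \<^const>\<open>prob_space.indep_var\<close> forces both random variables to have the same
  codomain type; this is the heterogeneous version, stated through the generated sigma-algebras.
\<close>

definition indep_rv ::
  "'w measure \<Rightarrow> 'a measure \<Rightarrow> ('w \<Rightarrow> 'a) \<Rightarrow> 'b measure \<Rightarrow> ('w \<Rightarrow> 'b) \<Rightarrow> bool" where
  "indep_rv M S X T Y \<longleftrightarrow> X \<in> M \<rightarrow>\<^sub>M S \<and> Y \<in> M \<rightarrow>\<^sub>M T \<and>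
     prob_space.indep_set M {X -` A \<inter> space M |A. A \<in> sets S} {Y -` B \<inter> space M |B. B \<in> sets T}"

text \<open>\<open>\<kappa>\<close> is a regular conditional distribution of \<open>X\<close> given \<open>Y\<close>.\<close>

definition regular_cond_distr ::
  "'w measure \<Rightarrow> ('w \<Rightarrow> 'a::topological_space) \<Rightarrow> ('w \<Rightarrow> 'b::topological_space) \<Rightarrow> ('b \<Rightarrow> 'a measure) \<Rightarrow> bool"
  where
  "regular_cond_distr M X Y \<kappa> \<longleftrightarrow> \<kappa> \<in> borel \<rightarrow>\<^sub>M prob_algebra borel \<and>
     (\<forall>A\<in>sets borel. \<forall>B\<in>sets borel.
        emeasure M {\<omega>\<in>space M. X \<omega> \<in> A \<and> Y \<omega> \<in> B} = (\<integral>\<^sup>+y\<in>B. emeasure (\<kappa> y) A \<partial>distr M borel Y))"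

definition alg_loss ::
  "('x \<times> 'p \<Rightarrow> ennreal) \<Rightarrow> ('h \<times> 'x \<times> 'p \<Rightarrow> 'x) \<Rightarrow> 'x \<Rightarrow> 'h \<Rightarrow> 'p \<Rightarrow> ennreal" where
  "alg_loss l A x0 h p = l (A (h, x0, p), p)"

text \<open>
  From here on \<open>L\<close> is the composed loss \<open>alg_loss l A x0\<close>, \<open>\<kappa>\<close> the regular conditional
  distribution of \<open>P\<close> given \<open>H\<close>, \<open>\<mu>\<close> the law of \<open>P\<close> and \<open>\<nu>\<close> the law of \<open>H\<close>.

  The comparison \<open>L h p \<le> g p\<close> is made in the extended reals, since \<^term>\<open>ennreal (g p)\<close>
  would truncate negative values of \<open>g p\<close> to 0. On the sublevel set \<open>L\<close> is finite, so
  \<^const>\<open>enn2real\<close> below loses nothing; off it the indicator vanishes (with 0 times infinity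
  being 0).
\<close>

definition sublevel_set :: "('h \<Rightarrow> 'p \<Rightarrow> ennreal) \<Rightarrow> ('p \<Rightarrow> real) \<Rightarrow> ('h \<times> 'p) set" where
  "sublevel_set L g = {(h, p). enn2ereal (L h p) \<le> ereal (g p)}"

definition sublevel_section :: "('h \<Rightarrow> 'p \<Rightarrow> ennreal) \<Rightarrow> ('p \<Rightarrow> real) \<Rightarrow> 'h \<Rightarrow> 'p set" where
  "sublevel_section L g h = {p. (h, p) \<in> sublevel_set L g}"

definition sublevel_prob ::
  "('h \<Rightarrow> 'p measure) \<Rightarrow> ('h \<Rightarrow> 'p \<Rightarrow> ennreal) \<Rightarrow> ('p \<Rightarrow> real) \<Rightarrow> 'h \<Rightarrow> real" where
  "sublevel_prob \<kappa> L g h = measure (\<kappa> h) (sublevel_section L g h)"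

definition sublevel_risk ::
  "'p measure \<Rightarrow> ('h \<Rightarrow> 'p measure) \<Rightarrow> ('h \<Rightarrow> 'p \<Rightarrow> ennreal) \<Rightarrow> ('p \<Rightarrow> real) \<Rightarrow> 'h \<Rightarrow> real" where
  "sublevel_risk \<mu> \<kappa> L g h =
     (if sublevel_prob \<kappa> L g h > 0
      then 1 / sublevel_prob \<kappa> L g h *
             (\<integral>p. enn2real (L h p) * indicator (sublevel_section L g h) p \<partial>\<mu>)
      else 0)"

text \<open>
  Where the sublevel probability is 0, the next two definitions rely on division by zero being 0;
  under the hypotheses of the theorem such \<open>h\<close> form a null set. A data set
  \<open>d = (p\<^sub>1, \<dots>, p\<^sub>N)\<close> is a function on \<open>{1..N}\<close>.
\<close>

definition emp_sublevel_risk ::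
  "('h \<Rightarrow> 'p measure) \<Rightarrow> ('h \<Rightarrow> 'p \<Rightarrow> ennreal) \<Rightarrow> ('p \<Rightarrow> real) \<Rightarrow> nat \<Rightarrow> 'h \<Rightarrow> (nat \<Rightarrow> 'p) \<Rightarrow> real" where
  "emp_sublevel_risk \<kappa> L g N h d =
     1 / sublevel_prob \<kappa> L g h *
       (1 / real N * (\<Sum>i=1..N. indicator (sublevel_section L g h) (d i) * enn2real (L h (d i))))"

definition suff_stat ::
  "'p measure \<Rightarrow> ('h \<Rightarrow> 'p measure) \<Rightarrow> ('h \<Rightarrow> 'p \<Rightarrow> ennreal) \<Rightarrow> ('p \<Rightarrow> real) \<Rightarrow> nat
     \<Rightarrow> 'h \<Rightarrow> (nat \<Rightarrow> 'p) \<Rightarrow> real \<times> real" where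
  "suff_stat \<mu> \<kappa> L g N h d =
     (sublevel_risk \<mu> \<kappa> L g h - emp_sublevel_risk \<kappa> L g N h d,
      1 / ((sublevel_prob \<kappa> L g h)\<^sup>2 * real N) *
        (\<integral>p. (g p)\<^sup>2 * indicator (sublevel_section L g h) p \<partial>\<mu>))"

definition nat_param :: "real \<Rightarrow> real \<times> real" where
  "nat_param \<gamma> = (\<gamma>, - (\<gamma>\<^sup>2 / 2))"

text \<open>The integral is taken in \<open>[0, \<infinity>]\<close>: it need not be finite for every \<open>d\<close>.\<close>

definition normalizer ::
  "'p measure \<Rightarrow> 'h measure \<Rightarrow> ('h \<Rightarrow> 'p measure) \<Rightarrow> ('h \<Rightarrow> 'p \<Rightarrow> ennreal) \<Rightarrow> ('p \<Rightarrow> real) \<Rightarrow> nat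
     \<Rightarrow> real \<Rightarrow> (nat \<Rightarrow> 'p) \<Rightarrow> ennreal" where
  "normalizer \<mu> \<nu> \<kappa> L g N \<gamma> d =
     (\<integral>\<^sup>+h. ennreal (exp (nat_param \<gamma> \<bullet> suff_stat \<mu> \<kappa> L g N h d)) \<partial>\<nu>)"

definition sample :: "nat \<Rightarrow> (nat \<Rightarrow> 'w \<Rightarrow> 'p) \<Rightarrow> 'w \<Rightarrow> nat \<Rightarrow> 'p" where
  "sample N Ps \<omega> = (\<lambda>i\<in>{1..N}. Ps i \<omega>)"

end

theory Submission
  imports Defs
begin

text \<open>
  For nonnegative \<open>X\<close> the bound \<open>exp (- x) \<le> 1 - x + x\<^sup>2 / 2\<close> (\<open>x \<ge> 0\<close>) makes the lower tail
  sub-Gaussian with only a second moment: \<open>E exp (t (E X - X)) \<le> exp (t\<^sup>2 E X\<^sup>2 / 2)\<close> for \<open>t \<ge> 0\<close>.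
  For fixed \<open>h\<close> apply it to \<open>X = L h p\<close> restricted to the sublevel set, whose square is at most
  \<open>g\<^sup>2\<close> there, with \<open>t = \<gamma> / (\<pi> h * N)\<close>. The exponential in \<open>c(\<gamma>, d)\<close> is then a product of \<open>N\<close>
  factors with mean at most 1, so the claim follows from independence and Tonelli.

  Where \<open>\<pi> h = 0\<close>, division by zero gives \<open>t = 0\<close> and the exponential is 1.
\<close>

text \<open>Taylor expansion at 0 with Lagrange remainder of order 3: the remainder is a positive
  multiple of \<open>(- x) ^ 3\<close>, hence nonpositive for \<open>x \<ge> 0\<close>.\<close>

lemma exp_minus_le_quadratic:
  fixes x :: real
  assumes "0 \<le> x"
  shows "exp (- x) \<le> 1 - x + x\<^sup>2 / 2"
proof -
  obtain s where "exp (- x) = (\<Sum>m<3. (- x) ^ m / fact m) + exp s / fact 3 * (- x) ^ 3"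
    using Maclaurin_exp_le[of "- x" 3] by auto
  moreover have "exp s / fact 3 * (- x) ^ 3 \<le> 0"
    using assms by (intro mult_nonneg_nonpos) (auto simp: power3_eq_cube)
  ultimately show ?thesis
    by (simp add: eval_nat_numeral)
qed

text \<open>Taking means in the quadratic bound leaves only the first two moments of
  \<open>X\<close>; then \<open>1 + y \<le> exp y\<close> turns the result into the exponential that
  cancels the prefactor \<open>?c\<close>. The bound \<open>v\<close> may exceed the second moment,
  since later \<open>v\<close> comes from \<open>g\<close> while \<open>X\<close> is the
  loss.\<close>

lemma (in prob_space) nn_integral_exp_lower_tail_le_1:
  fixes X :: "'a \<Rightarrow> real"
  assumes [measurable]: "X \<in> borel_measurable M"
    and nonneg: "\<And>x. x \<in> space M \<Longrightarrow> 0 \<le> X x"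
    and sq: "integrable M (\<lambda>x. (X x)\<^sup>2)"
    and v: "expectation (\<lambda>x. (X x)\<^sup>2) \<le> v"
    and t: "0 \<le> t"
  shows "(\<integral>\<^sup>+x. ennreal (exp (t * (expectation X - X x) - t\<^sup>2 / 2 * v)) \<partial>M) \<le> 1"
proof -
  let ?m = "expectation X" and ?q = "\<lambda>x. 1 - t * X x + t\<^sup>2 / 2 * (X x)\<^sup>2"
  let ?c = "exp (t * ?m - t\<^sup>2 / 2 * v)"
  have int: "integrable M X"
    using sq by (rule square_integrable_imp_integrable[rotated]) simp
  have q: "exp (- (t * X x)) \<le> ?q x" if "x \<in> space M" for x
    using exp_minus_le_quadratic[of "t * X x"] nonneg[OF that] t by (simp add: power_mult_distrib)
  have "(\<integral>\<^sup>+x. ennreal (exp (t * (?m - X x) - t\<^sup>2 / 2 * v)) \<partial>M) \<le> (\<integral>\<^sup>+x. ennreal (?c * ?q x) \<partial>M)"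
  proof (intro nn_integral_mono ennreal_leI)
    fix x assume "x \<in> space M"
    have "exp (t * (?m - X x) - t\<^sup>2 / 2 * v) = ?c * exp (- (t * X x))"
      by (simp add: exp_add[symmetric] algebra_simps)
    also have "\<dots> \<le> ?c * ?q x"
      using q[OF \<open>x \<in> space M\<close>] by (intro mult_left_mono) auto
    finally show "exp (t * (?m - X x) - t\<^sup>2 / 2 * v) \<le> ?c * ?q x" .
  qed
  also have "\<dots> = ennreal (expectation (\<lambda>x. ?c * ?q x))"
  proof (intro nn_integral_eq_integral AE_I2)
    show "integrable M (\<lambda>x. ?c * ?q x)" using int sq by auto
    show "0 \<le> ?c * ?q x" if "x \<in> space M" for x
      using order_trans[OF exp_ge_zero q[OF that]] by simp
  qed
  also have "expectation (\<lambda>x. ?c * ?q x) = ?c * (1 - t * ?m + t\<^sup>2 / 2 * expectation (\<lambda>x. (X x)\<^sup>2))"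
    using int sq by (simp add: prob_space)
  also have "\<dots> \<le> ?c * exp (- (t * ?m - t\<^sup>2 / 2 * v))"
  proof (intro mult_left_mono)
    have "t\<^sup>2 / 2 * expectation (\<lambda>x. (X x)\<^sup>2) \<le> t\<^sup>2 / 2 * v"
      using v by (intro mult_left_mono) auto
    then show "1 - t * ?m + t\<^sup>2 / 2 * expectation (\<lambda>x. (X x)\<^sup>2) \<le> exp (- (t * ?m - t\<^sup>2 / 2 * v))"
      using exp_ge_add_one_self[of "- (t * ?m - t\<^sup>2 / 2 * v)"] by linarith
  qed simp
  also have "\<dots> = 1"
    by (simp add: exp_add[symmetric])
  finally show ?thesis
    by (simp add: ennreal_leI)
qed

text \<open>\<open>P\<close> sits at index 0, so \<open>iid\<close> also equates its law with that
  of each \<open>Ps i\<close>. On \<open>{1..N}\<close> the update at 0 is invisible, and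
  independence there means that the joint law is the product law.\<close>

lemma (in prob_space) distr_sample_iid:
  fixes P :: "'a \<Rightarrow> 'p::topological_space"
  assumes "iid M (Ps(0 := P)) {0..N}" and "N \<ge> 1"
  shows "distr M (PiM {1..N} (\<lambda>_. borel)) (sample N Ps) = PiM {1..N} (\<lambda>_. distr M borel P)"
proof -
  have ind: "indep_vars (\<lambda>_. borel) (Ps(0 := P)) {0..N}"
    and eq: "\<And>i. i \<in> {0..N} \<Longrightarrow> distr M borel ((Ps(0 := P)) i) = distr M borel ((Ps(0 := P)) 0)"
    using assms(1) unfolding iid_def by (blast, metis atLeastAtMost_iff order_refl zero_le)
  have "indep_vars (\<lambda>_. borel) (Ps(0 := P)) {1..N}"
    using ind by (rule indep_vars_subset) auto
  then have ind': "indep_vars (\<lambda>_. borel) Ps {1..N}"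
    by (subst indep_vars_cong[where Y = "Ps(0 := P)" and J = "{1..N}" and N' = "\<lambda>_. borel"]) auto
  then have rv: "\<And>i. i \<in> {1..N} \<Longrightarrow> random_variable borel (Ps i)"
    by (auto simp: indep_vars_def)
  have law: "distr M borel (Ps i) = distr M borel P" if "i \<in> {1..N}" for i
    using eq[of i] that by auto
  have "distr M (PiM {1..N} (\<lambda>_. borel)) (\<lambda>x. \<lambda>i\<in>{1..N}. Ps i x) =
      PiM {1..N} (\<lambda>i. distr M borel (Ps i))"
    \<comment> \<open>The characterization of independence by the product law asks for a nonempty
      index set, hence \<open>N \<ge> 1\<close>.\<close>
    using ind' rv assms(2) by (subst (asm) indep_vars_iff_distr_eq_PiM') auto
  also have "\<dots> = PiM {1..N} (\<lambda>_. distr M borel P)"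
    by (intro PiM_cong) (auto simp: law)
  finally show ?thesis by (simp add: sample_def[abs_def])
qed

lemma measurable_alg_loss:
  assumes [measurable]: "l \<in> borel_measurable (borel \<Otimes>\<^sub>M borel)"
    "A \<in> (borel \<Otimes>\<^sub>M (borel \<Otimes>\<^sub>M borel)) \<rightarrow>\<^sub>M borel"
  shows "(\<lambda>z. alg_loss l A x0 (fst z) (snd z)) \<in> borel_measurable (borel \<Otimes>\<^sub>M borel)"
  unfolding alg_loss_def by measurable

text \<open>\<open>\<kappa>\<close> enters through \<open>sublevel_prob\<close> alone, that is,
  through the scale \<open>t\<close>. The tail bound holds at every scale \<open>t \<ge> 0\<close>;
  measurability of \<open>\<kappa>\<close> serves Tonelli.\<close>

locale sublevel =
  fixes L :: "'h::topological_space \<Rightarrow> 'p::topological_space \<Rightarrow> ennreal" and g :: "'p \<Rightarrow> real"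
    and \<mu> :: "'p measure" and \<kappa> :: "'h \<Rightarrow> 'p measure"
  assumes prob_\<mu>: "prob_space \<mu>" and sets_\<mu>[measurable_cong]: "sets \<mu> = sets borel"
    and L_meas: "(\<lambda>z. L (fst z) (snd z)) \<in> borel_measurable (borel \<Otimes>\<^sub>M borel)"
    and g_meas[measurable]: "g \<in> borel_measurable borel"
    and g_sq: "integrable \<mu> (\<lambda>p. (g p)\<^sup>2)"
    and \<kappa>_meas: "\<kappa> \<in> borel \<rightarrow>\<^sub>M prob_algebra borel"
begin

sublocale prob_space \<mu> by (fact prob_\<mu>)

text \<open>The nonnegative variable \<open>X\<close> of the tail bound, for fixed
  \<open>h\<close>.\<close>

definition loss :: "'h \<Rightarrow> 'p \<Rightarrow> real" where
  "loss h p = indicator (sublevel_section L g h) p * enn2real (L h p)"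

lemma sublevel_set_sets: "sublevel_set L g \<in> sets (borel \<Otimes>\<^sub>M borel)"
proof -
  note L_meas[measurable]
  have "sublevel_set L g =
      {z \<in> space (borel \<Otimes>\<^sub>M borel). enn2ereal (L (fst z) (snd z)) \<le> ereal (g (snd z))}"
    by (auto simp: sublevel_set_def space_pair_measure)
  also have "\<dots> \<in> sets (borel \<Otimes>\<^sub>M borel)" by measurable
  finally show ?thesis .
qed

text \<open>Trades a set that varies with \<open>h\<close> for one fixed set of pairs, which gives
  joint measurability in \<open>h\<close> and \<open>p\<close>.\<close>

lemma indicator_section:
  "indicator (sublevel_section L g h) p = indicator (sublevel_set L g) (h, p)"
  by (auto simp: sublevel_section_def split: split_indicator)

lemma section_measurable[measurable]:
  "(\<lambda>z. indicator (sublevel_section L g (fst z)) (snd z) :: real) \<in> borel_measurable (borel \<Otimes>\<^sub>M borel)"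
  unfolding indicator_section using sublevel_set_sets by simp

lemma section_sets[measurable]: "sublevel_section L g h \<in> sets borel"
proof -
  have "sublevel_section L g h = Pair h -` sublevel_set L g"
    by (auto simp: sublevel_section_def)
  then show ?thesis using sets_Pair1[OF sublevel_set_sets] by simp
qed

lemma loss_measurable: "(\<lambda>z. loss (fst z) (snd z)) \<in> borel_measurable (borel \<Otimes>\<^sub>M borel)"
  using L_meas[measurable] unfolding loss_def by measurable

lemma loss_measurable1[measurable]: "loss h \<in> borel_measurable borel"
  using measurable_compose[OF measurable_Pair1'[of h borel borel] loss_measurable] by simp

lemma loss_nonneg: "0 \<le> loss h p"
  by (simp add: loss_def)

text \<open>On the section, \<open>0 \<le> L h p \<le> g p\<close>, so squaring preserves the order
  even though \<open>g\<close> may be negative elsewhere. Off the section both sides vanish.\<close>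

lemma loss_sq_le: "(loss h p)\<^sup>2 \<le> (g p)\<^sup>2 * indicator (sublevel_section L g h) p"
proof (cases "p \<in> sublevel_section L g h")
  case True
  then have "enn2ereal (L h p) \<le> ereal (g p)"
    by (simp add: sublevel_section_def sublevel_set_def)
  then have "enn2real (L h p) \<le> g p"
    \<comment> \<open>An infinite loss is excluded because \<open>g p\<close> is a real
      number.\<close>
    by (cases "L h p") (auto simp: enn2ereal_ennreal)
  then show ?thesis
    using True by (auto simp: loss_def intro!: power_mono)
qed (simp add: loss_def)

lemma g_sq_section: "integrable \<mu> (\<lambda>p. (g p)\<^sup>2 * indicator (sublevel_section L g h) p)"
  by (intro integrable_real_mult_indicator g_sq) (simp add: sets_\<mu>)

lemma loss_sq: "integrable \<mu> (\<lambda>p. (loss h p)\<^sup>2)"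
  by (rule Bochner_Integration.integrable_bound[OF g_sq_section[of h]])
     (use loss_sq_le in \<open>auto intro: order_trans\<close>)

lemma sublevel_prob_measurable[measurable]: "sublevel_prob \<kappa> L g \<in> borel_measurable borel"
  unfolding sublevel_prob_def[abs_def]
proof (rule measure_measurable_subprob_algebra2)
  show "\<kappa> \<in> borel \<rightarrow>\<^sub>M subprob_algebra borel"
    using \<kappa>_meas by (rule measurable_prob_algebraD)
  have "(SIGMA x:space borel. sublevel_section L g x) = sublevel_set L g"
    by (auto simp: sublevel_section_def)
  then show "(SIGMA x:space borel. sublevel_section L g x) \<in> sets (borel \<Otimes>\<^sub>M borel)"
    using sublevel_set_sets by simp
qed

text \<open>The parameter \<open>t\<close> of the tail bound.\<close>

definition rate :: "real \<Rightarrow> nat \<Rightarrow> 'h \<Rightarrow> real" where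
  "rate \<gamma> N h = \<gamma> / (sublevel_prob \<kappa> L g h * real N)"

text \<open>The integrand of the tail bound with \<open>X = loss h\<close> and with \<open>v\<close>
  the second moment of \<open>g\<close> on the section: the share of one data point in the
  exponential.\<close>

definition factor :: "real \<Rightarrow> nat \<Rightarrow> 'h \<Rightarrow> 'p \<Rightarrow> real" where
  "factor \<gamma> N h p = exp (rate \<gamma> N h * (expectation (loss h) - loss h p) -
     (rate \<gamma> N h)\<^sup>2 / 2 * (\<integral>q. (g q)\<^sup>2 * indicator (sublevel_section L g h) q \<partial>\<mu>))"

text \<open>With \<open>t = rate \<gamma> N h\<close>, the coefficients satisfy
  \<open>\<gamma> / \<pi> h = N * t\<close> and \<open>\<gamma>\<^sup>2 / (2 * (\<pi> h)\<^sup>2 *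
  N) = N * (t\<^sup>2 / 2)\<close>, so the exponent is a sum of one term per data point.\<close>

lemma exp_suff_stat_eq_prod_factor:
  assumes "N \<ge> 1"
  shows "exp (nat_param \<gamma> \<bullet> suff_stat \<mu> \<kappa> L g N h d) = (\<Prod>i=1..N. factor \<gamma> N h (d i))"
proof -
  \<comment> \<open>The case distinction in \<open>sublevel_risk\<close> disappears because
    \<open>1 / 0 = 0\<close>.\<close>
  have "sublevel_risk \<mu> \<kappa> L g h = 1 / sublevel_prob \<kappa> L g h * expectation (loss h)"
    by (auto simp: sublevel_risk_def loss_def[abs_def] sublevel_prob_def mult.commute
        zero_less_measure_iff)
  moreover have "(\<Sum>i=1..N. rate \<gamma> N h * (expectation (loss h) - loss h (d i)) - c) =
      rate \<gamma> N h * (real N * expectation (loss h) - (\<Sum>i=1..N. loss h (d i))) - real N * c" for c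
    by (simp add: sum_subtractf flip: sum_distrib_left)
  ultimately have "nat_param \<gamma> \<bullet> suff_stat \<mu> \<kappa> L g N h d =
      (\<Sum>i=1..N. rate \<gamma> N h * (expectation (loss h) - loss h (d i)) -
        (rate \<gamma> N h)\<^sup>2 / 2 * (\<integral>q. (g q)\<^sup>2 * indicator (sublevel_section L g h) q \<partial>\<mu>))"
    using assms
    by (cases "sublevel_prob \<kappa> L g h = 0";
        simp add: nat_param_def suff_stat_def emp_sublevel_risk_def rate_def flip: loss_def)
       (simp add: field_simps power2_eq_square)
  then show ?thesis
    by (simp add: factor_def exp_sum)
qed

lemma nn_integral_factor_le_1:
  assumes "0 \<le> \<gamma>"
  shows "(\<integral>\<^sup>+p. ennreal (factor \<gamma> N h p) \<partial>\<mu>) \<le> 1"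
  unfolding factor_def
proof (rule nn_integral_exp_lower_tail_le_1)
  show "expectation (\<lambda>p. (loss h p)\<^sup>2) \<le> (\<integral>q. (g q)\<^sup>2 * indicator (sublevel_section L g h) q \<partial>\<mu>)"
    by (intro integral_mono loss_sq g_sq_section loss_sq_le)
  show "0 \<le> rate \<gamma> N h"
    using assms by (simp add: rate_def sublevel_prob_def)
qed (use loss_nonneg loss_sq in auto)

text \<open>Joint measurability allows the integrals over \<open>h\<close> and over the data to be
  exchanged. The mean and the second moment depend on \<open>h\<close> as parameter integrals, so
  they are measurable in \<open>h\<close>.\<close>

lemma factor_measurable: "(\<lambda>z. factor \<gamma> N (fst z) (snd z)) \<in> borel_measurable (borel \<Otimes>\<^sub>M borel)"
proof -
  note loss_measurable[measurable]
  have [measurable]: "(\<lambda>h. expectation (loss h)) \<in> borel_measurable borel"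
    using borel_measurable_lebesgue_integral[of loss borel] loss_measurable
    by (simp add: case_prod_beta' cong: measurable_cong_sets)
  have [measurable]:
    "(\<lambda>h. \<integral>q. (g q)\<^sup>2 * indicator (sublevel_section L g h) q \<partial>\<mu>) \<in> borel_measurable borel"
    using section_measurable by (intro borel_measurable_lebesgue_integral) (simp add: case_prod_beta')
  show ?thesis
    unfolding factor_def rate_def by measurable
qed

text \<open>Under the product law the data can be integrated first, with \<open>h\<close> fixed.
  Measurability is recorded too, since the main theorem pulls \<open>normalizer\<close> back along
  \<open>sample\<close>.\<close>

lemma nn_integral_normalizer_le_1:
  assumes "prob_space \<nu>" and sets_\<nu>[measurable_cong]: "sets \<nu> = sets borel"
    and "N \<ge> 1" and "0 \<le> \<gamma>"
  shows "normalizer \<mu> \<nu> \<kappa> L g N \<gamma> \<in> borel_measurable (PiM {1..N} (\<lambda>_. \<mu>))" (is ?meas)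
    and "(\<integral>\<^sup>+d. normalizer \<mu> \<nu> \<kappa> L g N \<gamma> d \<partial>PiM {1..N} (\<lambda>_. \<mu>)) \<le> 1" (is ?le)
proof -
  interpret \<nu>: prob_space \<nu> by fact
  interpret prod: product_prob_space "\<lambda>_::nat. \<mu>" "{1..N}"
    by unfold_locales
  interpret pair: pair_sigma_finite \<nu> "PiM {1..N} (\<lambda>_. \<mu>)"
    by unfold_locales
  let ?F = "\<lambda>h d. \<Prod>i=1..N. ennreal (factor \<gamma> N h (d i))"
  have [measurable]: "(\<lambda>z. factor \<gamma> N (fst z) (snd z i)) \<in>
      borel_measurable (\<nu> \<Otimes>\<^sub>M PiM {1..N} (\<lambda>_. \<mu>))" if "i \<in> {1..N}" for i
    using that by (intro measurable_compose[OF _ factor_measurable, where f = "\<lambda>z. (fst z, snd z i)",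
      simplified]) measurable
  have F: "(\<lambda>(h, d). ?F h d) \<in> borel_measurable (\<nu> \<Otimes>\<^sub>M PiM {1..N} (\<lambda>_. \<mu>))"
    unfolding case_prod_beta' by measurable
  \<comment> \<open>Each \<open>factor\<close> is positive, so \<open>ennreal\<close> commutes with
    the product, and Tonelli applies in \<open>[0, \<infinity>]\<close> without an integrability
    condition.\<close>
  have norm: "normalizer \<mu> \<nu> \<kappa> L g N \<gamma> = (\<lambda>d. \<integral>\<^sup>+h. ?F h d \<partial>\<nu>)"
    using \<open>N \<ge> 1\<close>
    by (simp add: normalizer_def[abs_def] exp_suff_stat_eq_prod_factor prod_ennreal factor_def)
  show ?meas
    unfolding norm using measurable_pair_swap[OF F]
    by (intro \<nu>.borel_measurable_nn_integral) (simp add: case_prod_beta')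
  have "(\<integral>\<^sup>+d. normalizer \<mu> \<nu> \<kappa> L g N \<gamma> d \<partial>PiM {1..N} (\<lambda>_. \<mu>)) =
      (\<integral>\<^sup>+h. (\<integral>\<^sup>+d. ?F h d \<partial>PiM {1..N} (\<lambda>_. \<mu>)) \<partial>\<nu>)"
    unfolding norm by (rule pair.Fubini'[OF F])
  \<comment> \<open>For fixed \<open>h\<close> the factors depend on distinct coordinates of
    \<open>d\<close>, so the product measure splits the integral.\<close>
  also have "\<dots> = (\<integral>\<^sup>+h. (\<Prod>i=1..N. \<integral>\<^sup>+p. ennreal (factor \<gamma> N h p) \<partial>\<mu>) \<partial>\<nu>)"
    by (intro nn_integral_cong prod.product_nn_integral_prod) (auto simp: factor_def)
  also have "\<dots> \<le> (\<integral>\<^sup>+h. 1 \<partial>\<nu>)"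
    using nn_integral_factor_le_1[OF \<open>0 \<le> \<gamma>\<close>]
    by (intro nn_integral_mono prod_le_1) auto
  also have "\<dots> = 1" by (simp add: \<nu>.emeasure_space_1)
  finally show ?le .
qed

end

theorem mainTheorem3:
  fixes M :: "'w measure"
    and l :: "(real ^ 'n) \<times> 'p::polish_space \<Rightarrow> ennreal"
    and A :: "'h::polish_space \<times> (real ^ 'n) \<times> 'p \<Rightarrow> real ^ 'n"
    and x0 :: "real ^ 'n"
    and P :: "'w \<Rightarrow> 'p" and Ps :: "nat \<Rightarrow> 'w \<Rightarrow> 'p" and H :: "'w \<Rightarrow> 'h"
    and N :: nat
    and g :: "'p \<Rightarrow> real"
    and \<kappa> :: "'h \<Rightarrow> 'p measure"
    and \<gamma> :: real
  assumes "prob_space M"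
    and "l \<in> borel_measurable (borel \<Otimes>\<^sub>M borel)"
    and "A \<in> borel_measurable (borel \<Otimes>\<^sub>M (borel \<Otimes>\<^sub>M borel))"
    and "N \<ge> 1"
    and "iid M (Ps(0 := P)) {0..N}"
    and "indep_rv M borel H (PiM {1..N} (\<lambda>_. borel)) (sample N Ps)"
    and "indep_rv M borel H borel P"
    and "regular_cond_distr M P H \<kappa>"
    and "g \<in> borel_measurable borel"
    and "integrable (distr M borel P) (\<lambda>p. (g p)\<^sup>2)"
    and "measure (distr M borel H) {h. sublevel_prob \<kappa> (alg_loss l A x0) g h > 0} = 1"
    and "\<gamma> > 0"
  shows "(\<integral>\<^sup>+\<omega>. normalizer (distr M borel P) (distr M borel H) \<kappa> (alg_loss l A x0) g N \<gamma>
            (sample N Ps \<omega>) \<partial>M) \<le> 1"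
proof -
  interpret prob_space M by fact
  let ?\<mu> = "distr M borel P" and ?\<nu> = "distr M borel H" and ?L = "alg_loss l A x0"
  have P: "P \<in> M \<rightarrow>\<^sub>M borel" and H: "H \<in> M \<rightarrow>\<^sub>M borel"
    and S: "sample N Ps \<in> M \<rightarrow>\<^sub>M PiM {1..N} (\<lambda>_. borel)"
    using assms(6,7) by (auto simp: indep_rv_def)
  interpret sub: sublevel ?L g ?\<mu> \<kappa>
  proof (rule sublevel.intro)
    show "prob_space ?\<mu>" using P by (rule prob_space_distr)
    show "(\<lambda>z. ?L (fst z) (snd z)) \<in> borel_measurable (borel \<Otimes>\<^sub>M borel)"
      using assms(2,3) by (rule measurable_alg_loss)
    show "\<kappa> \<in> borel \<rightarrow>\<^sub>M prob_algebra borel"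
      using assms(8) by (simp only: regular_cond_distr_def)
  qed (use assms(9,10) in simp_all)
  note normalizer = sub.nn_integral_normalizer_le_1[of ?\<nu> N \<gamma>,
      OF prob_space_distr[OF H] _ assms(4) less_imp_le[OF assms(12)]]
  have meas: "normalizer ?\<mu> ?\<nu> \<kappa> ?L g N \<gamma> \<in> borel_measurable (PiM {1..N} (\<lambda>_. borel))"
    using normalizer(1) by (simp cong: measurable_cong_sets sets_PiM_cong)
  \<comment> \<open>Change of variables to the law of the data, which is the product of
    \<open>N\<close> copies of the law of \<open>P\<close>.\<close>
  have "(\<integral>\<^sup>+\<omega>. normalizer ?\<mu> ?\<nu> \<kappa> ?L g N \<gamma> (sample N Ps \<omega>) \<partial>M) =
      (\<integral>\<^sup>+d. normalizer ?\<mu> ?\<nu> \<kappa> ?L g N \<gamma> d \<partial>distr M (PiM {1..N} (\<lambda>_. borel)) (sample N Ps))"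
    using S meas by (simp add: nn_integral_distr)
  also have "\<dots> \<le> 1"
    unfolding distr_sample_iid[OF assms(5,4)] by (rule normalizer(2)) simp
  finally show ?thesis .
qed

end
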